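(* Assume $\mathrm{CSN}(\mathbf{\Delta}^1_1)>\omega_1$, where $\mathbf{\Delta}^1_1$ is the family of Borel subsets of $2^\omega$. Let $\pi$ be a cardinality-preserving automorphism of $\mathcal{P}(2^\omega)/\mathrm{Fin}$ which is trivial on every countable subset of $2^\omega$. Then $\pi$ is trivial.
   Context: For $\Gamma\subseteq\mathcal{P}(2^\omega)$, $\mathrm{CSN}(\Gamma)$ is the least cardinality of a family $\mathcal{F}\subseteq(2^\omega)^\omega\times(2^\omega)^\omega$ such that: (1) for every $(f,g)\in\mathcal{F}$, $\{f(n)\}_n\cup\{g(n)\}_n$ is dense in $2^\omega$; (2) for $(f,g),(f',g')\in\mathcal{F}$ with $g\neq g'$, $\{g(n)\}_n\cap\{g'(n)\}_n=\emptyset$; (3) $f(n)\neq g(n)$ for all $(f,g)\in\mathcal{F}$, $n<\omega$; (4) for every $A\in\Gamma$, the set of $(f,g)\in\mathcal{F}$ with infinitely many $n$ such that $|A\cap\{f(n),g(n)\}|=1$ has cardinality less than $|\mathcal{F}|$; if no such family exists, $\mathrm{CSN}(\Gamma)=(2^{\aleph_0})^+$. $\mathrm{Fin}$ is the ideal of finite subsets. $\pi$ is cardinality-preserving if for every $A$ there is $B$ with $|B|=|A|$ and $\pi([A])=[B]$. $\pi$ is trivial (on $Z$) if there is $f:2^\omega\to 2^\omega$ (resp. $f:2^\omega\to Z$) with $\pi([A])=[f^{-1}(A)]$ for all $A\subseteq 2^\omega$ (resp. all $A\subseteq Z$). *)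

theory Defs
  imports "HOL-Analysis.Analysis"
begin

no_notation elt_set_eq (infix \<open>=o\<close> 50)

unbundle cardinal_syntax

text \<open>The Cantor space, with the product topology of the discrete topology on \<^typ>\<open>bool\<close>.\<close>

type_synonym cantor = "nat \<Rightarrow> bool"


section \<open>The Boolean algebra of subsets modulo finite sets\<close>

quotient_type 'a pow_fin = "'a set" / "\<lambda>A B. finite (sym_diff A B)"
proof (rule equivpI)
  show "reflp (\<lambda>A B :: 'a set. finite (sym_diff A B))"
    by (simp add: reflp_def)
  show "symp (\<lambda>A B :: 'a set. finite (sym_diff A B))"
    by (auto simp: symp_def)
  show "transp (\<lambda>A B :: 'a set. finite (sym_diff A B))"
  proof (rule transpI)
    fix A B C :: "'a set"
    assume "finite (sym_diff A B)" and "finite (sym_diff B C)"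
    then have "finite (sym_diff A B \<union> sym_diff B C)" by blast
    then show "finite (sym_diff A C)" by (rule rev_finite_subset) blast
  qed
qed

lift_definition fin_class :: "'a set \<Rightarrow> 'a pow_fin" is "\<lambda>A. A" .

lemma fin_class_eq_iff: "fin_class A = fin_class B \<longleftrightarrow> finite (sym_diff A B)"
  by transfer simp

instantiation pow_fin :: (type) boolean_algebra
begin

lift_definition bot_pow_fin :: "'a pow_fin" is "{}" .

lift_definition top_pow_fin :: "'a pow_fin" is "UNIV" .

lift_definition uminus_pow_fin :: "'a pow_fin \<Rightarrow> 'a pow_fin" is "\<lambda>A. - A"
  by (erule rev_finite_subset) blast

lift_definition inf_pow_fin :: "'a pow_fin \<Rightarrow> 'a pow_fin \<Rightarrow> 'a pow_fin" is "(\<inter>)"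
proof -
  fix A B C D :: "'a set"
  assume "finite (sym_diff A B)" and "finite (sym_diff C D)"
  then have "finite (sym_diff A B \<union> sym_diff C D)" by blast
  then show "finite (sym_diff (A \<inter> C) (B \<inter> D))" by (rule rev_finite_subset) blast
qed

lift_definition sup_pow_fin :: "'a pow_fin \<Rightarrow> 'a pow_fin \<Rightarrow> 'a pow_fin" is "(\<union>)"
proof -
  fix A B C D :: "'a set"
  assume "finite (sym_diff A B)" and "finite (sym_diff C D)"
  then have "finite (sym_diff A B \<union> sym_diff C D)" by blast
  then show "finite (sym_diff (A \<union> C) (B \<union> D))" by (rule rev_finite_subset) blast
qed

lift_definition minus_pow_fin :: "'a pow_fin \<Rightarrow> 'a pow_fin \<Rightarrow> 'a pow_fin" is "(-)"
proof -
  fix A B C D :: "'a set"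
  assume "finite (sym_diff A B)" and "finite (sym_diff C D)"
  then have "finite (sym_diff A B \<union> sym_diff C D)" by blast
  then show "finite (sym_diff (A - C) (B - D))" by (rule rev_finite_subset) blast
qed

lift_definition less_eq_pow_fin :: "'a pow_fin \<Rightarrow> 'a pow_fin \<Rightarrow> bool" is "\<lambda>A B. finite (A - B)"
proof -
  fix A B C D :: "'a set"
  assume "finite (sym_diff A B)" and "finite (sym_diff C D)"
  then have *: "finite (sym_diff A B \<union> sym_diff C D)" by blast
  have "A - C \<subseteq> (B - D) \<union> (sym_diff A B \<union> sym_diff C D)"
    and "B - D \<subseteq> (A - C) \<union> (sym_diff A B \<union> sym_diff C D)" by blast+
  then show "finite (A - C) \<longleftrightarrow> finite (B - D)"
    using * by (meson finite_Un finite_subset)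
qed

definition less_pow_fin :: "'a pow_fin \<Rightarrow> 'a pow_fin \<Rightarrow> bool" where
  "less_pow_fin x y \<longleftrightarrow> x \<le> y \<and> \<not> y \<le> x"

instance
proof
  fix x y z :: "'a pow_fin"
  show "x < y \<longleftrightarrow> x \<le> y \<and> \<not> y \<le> x" by (rule less_pow_fin_def)
  show "x \<le> x" by transfer simp
  show "x \<le> z" if "x \<le> y" "y \<le> z"
    using that
  proof transfer
    fix A B C :: "'a set"
    assume "finite (A - B)" "finite (B - C)"
    then have "finite ((A - B) \<union> (B - C))" by blast
    then show "finite (A - C)" by (rule rev_finite_subset) blast
  qed
  show "x = y" if "x \<le> y" "y \<le> x"
    using that by transfer simp
  show "inf x y \<le> x" by transfer (simp add: Diff_eq)
  show "inf x y \<le> y" by transfer (simp add: Diff_eq Int_assoc)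
  show "x \<le> inf y z" if "x \<le> y" "x \<le> z"
    using that by transfer (simp add: Diff_Int)
  show "x \<le> sup x y" by transfer (simp add: Diff_eq)
  show "y \<le> sup x y" by transfer (simp add: Diff_eq)
  show "sup y z \<le> x" if "y \<le> x" "z \<le> x"
    using that by transfer (simp add: Un_Diff)
  show "bot \<le> x" by transfer simp
  show "x \<le> top" by transfer simp
  show "sup x (inf y z) = inf (sup x y) (sup x z)"
    by transfer (simp add: Un_Int_distrib)
  show "inf x (- x) = bot" by transfer simp
  show "sup x (- x) = top" by transfer simp
  show "x - y = inf x (- y)" by transfer (simp add: Diff_eq)
qed

end

definition boolean_algebra_automorphism :: "('a::boolean_algebra \<Rightarrow> 'a) \<Rightarrow> bool" where
  "boolean_algebra_automorphism \<pi> \<longleftrightarrow>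
     bij \<pi> \<and> \<pi> bot = bot \<and> \<pi> top = top \<and>
     (\<forall>x y. \<pi> (inf x y) = inf (\<pi> x) (\<pi> y)) \<and>
     (\<forall>x y. \<pi> (sup x y) = sup (\<pi> x) (\<pi> y)) \<and>
     (\<forall>x. \<pi> (- x) = - \<pi> x)"

definition cardinality_preserving :: "('a pow_fin \<Rightarrow> 'a pow_fin) \<Rightarrow> bool" where
  "cardinality_preserving \<pi> \<longleftrightarrow> (\<forall>A. \<exists>B. |B| =o |A| \<and> \<pi> (fin_class A) = fin_class B)"

definition trivial_map :: "('a pow_fin \<Rightarrow> 'a pow_fin) \<Rightarrow> bool" where
  "trivial_map \<pi> \<longleftrightarrow> (\<exists>f :: 'a \<Rightarrow> 'a. \<forall>A. \<pi> (fin_class A) = fin_class (f -` A))"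

text \<open>
  The function into \<open>Z\<close> witnessing triviality on \<open>Z\<close> is partial, with domain \<open>D\<close>. The case
  \<open>A = Z\<close> forces \<open>\<pi> [Z] = [D]\<close>, so if \<open>D\<close> had to be the whole space, no automorphism at all would
  be trivial on any \<open>Z\<close> with infinite complement. A total function into \<open>Z\<close> is the case
  \<open>D = UNIV\<close>.
\<close>

definition trivial_map_on :: "'a set \<Rightarrow> ('a pow_fin \<Rightarrow> 'a pow_fin) \<Rightarrow> bool" where
  "trivial_map_on Z \<pi> \<longleftrightarrow>
     (\<exists>D. \<exists>f \<in> D \<rightarrow> Z. \<forall>A \<subseteq> Z. \<pi> (fin_class A) = fin_class {x \<in> D. f x \<in> A})"


section \<open>The cardinal invariant CSN\<close>

definition CSN_family ::
    "cantor set set \<Rightarrow> ((nat \<Rightarrow> cantor) \<times> (nat \<Rightarrow> cantor)) set \<Rightarrow> bool" where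
  "CSN_family \<Gamma> \<F> \<longleftrightarrow>
     (\<forall>(f, g) \<in> \<F>. closure (range f \<union> range g) = UNIV) \<and>
     (\<forall>(f, g) \<in> \<F>. \<forall>(f', g') \<in> \<F>. g \<noteq> g' \<longrightarrow> range g \<inter> range g' = {}) \<and>
     (\<forall>(f, g) \<in> \<F>. \<forall>n. f n \<noteq> g n) \<and>
     (\<forall>A \<in> \<Gamma>. |{(f, g) \<in> \<F>. infinite {n. card (A \<inter> {f n, g n}) = 1}}| <o |\<F>| )"

text \<open>
  \<open>is_CSN \<Gamma> r\<close> determines the cardinal \<open>r\<close> up to \<open>=o\<close>; \<open>CSN \<Gamma>\<close> is a representative on a type
  large enough for both cases of the definition.
\<close>

definition is_CSN :: "cantor set set \<Rightarrow> 'b rel \<Rightarrow> bool" where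
  "is_CSN \<Gamma> r \<longleftrightarrow> Card_order r \<and>
     (if \<exists>\<F>. CSN_family \<Gamma> \<F>
      then (\<exists>\<F>. CSN_family \<Gamma> \<F> \<and> r =o |\<F>| ) \<and> (\<forall>\<F>. CSN_family \<Gamma> \<F> \<longrightarrow> r \<le>o |\<F>| )
      else r =o cardSuc |UNIV :: cantor set| )"

definition CSN :: "cantor set set \<Rightarrow> cantor set rel" where
  "CSN \<Gamma> = (SOME r. is_CSN \<Gamma> r)"

lemma is_CSN_unique:
  assumes "is_CSN \<Gamma> r" and "is_CSN \<Gamma> s"
  shows "r =o s"
proof (cases "\<exists>\<F>. CSN_family \<Gamma> \<F>")
  case True
  then have "r \<le>o s" "s \<le>o r"
    using assms unfolding is_CSN_def
    by (metis ordIso_symmetric ordLeq_ordIso_trans)+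
  then show ?thesis by (simp add: ordIso_iff_ordLeq)
next
  case False
  then show ?thesis
    using assms unfolding is_CSN_def by (metis ordIso_symmetric ordIso_transitive)
qed

lemma is_CSN_CSN: "is_CSN \<Gamma> (CSN \<Gamma>)"
proof -
  have "\<exists>r :: cantor set rel. is_CSN \<Gamma> r"
  proof (cases "\<exists>\<F>. CSN_family \<Gamma> \<F>")
    case True
    let ?R = "{ |\<F>| | \<F>. CSN_family \<Gamma> \<F>}"
    have "\<exists>r \<in> ?R. \<forall>r' \<in> ?R. r \<le>o r'"
      by (rule exists_minim_Card_order) (use True in \<open>auto simp: card_of_Card_order\<close>)
    then obtain \<F> where F: "CSN_family \<Gamma> \<F>"
      and least: "\<And>\<F>'. CSN_family \<Gamma> \<F>' \<Longrightarrow> |\<F>| \<le>o |\<F>'|"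
      by blast
    define h :: "(nat \<Rightarrow> cantor) \<times> (nat \<Rightarrow> cantor) \<Rightarrow> cantor set" where
      "h = (\<lambda>(f, g). {\<lambda>m. case prod_decode m of (n, k) \<Rightarrow>
              if even n then f (n div 2) k else g (n div 2) k})"
    have "inj h"
    proof (rule injI, clarify)
      fix f g f' g' :: "nat \<Rightarrow> cantor"
      assume eq: "h (f, g) = h (f', g')"
      have *: "(if even n then f (n div 2) k else g (n div 2) k) =
               (if even n then f' (n div 2) k else g' (n div 2) k)" for n k
      proof -
        have "e (prod_encode (n, k)) = e' (prod_encode (n, k))" if "{e} = {e'}" for e e' :: cantor
          using that by simp
        from this [OF eq [unfolded h_def prod.case]] show ?thesis by simp
      qed
      have "f n k = f' n k" "g n k = g' n k" for n k
        using * [of "2 * n" k] * [of "2 * n + 1" k] by simp_all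
      then show "f = f' \<and> g = g'" by (simp add: fun_eq_iff)
    qed
    then have iso: "|h ` \<F>| =o |\<F>|"
      by (meson bij_betw_imageI card_of_ordIsoI inj_on_subset ordIso_symmetric subset_UNIV)
    have "is_CSN \<Gamma> |h ` \<F>|"
      unfolding is_CSN_def using True F iso least
      by (auto simp: card_of_Card_order intro: ordIso_ordLeq_trans)
    then show ?thesis by blast
  next
    case False
    then have "is_CSN \<Gamma> (cardSuc |UNIV :: cantor set| )"
      by (simp add: is_CSN_def cardSuc_Card_order card_of_Card_order ordIso_refl)
    then show ?thesis by blast
  qed
  then show ?thesis unfolding CSN_def by (rule someI_ex)
qed

end

theory Submission
  imports Defs "HOL-Library.Countable_Set_Type"
begin

text \<open>
  Lifting the images under \<open>\<pi>\<close> of the subbasic clopen sets pointwise gives a map \<open>f\<close> on the Cantor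
  space. Since \<open>\<pi>\<close> preserves countability, it induces a \<open>\<sigma>\<close>-homomorphism modulo countable sets, so
  \<open>f -` A\<close> represents \<open>\<pi>[A]\<close> up to a countable set for every Borel \<open>A\<close>; the same construction works
  for the pullback of the Borel sets along any map \<open>\<phi>\<close>.

  If \<open>f\<close> agrees modulo finite with the maps trivializing \<open>\<pi>\<close> on countable sets avoiding some
  fixed countable \<open>W\<close>, then correcting \<open>f\<close> on the preimage of \<open>W\<close> yields a trivialization of \<open>\<pi>\<close>.
  Otherwise there are \<open>\<omega>\<^sub>1\<close> pairwise disjoint countable sets on which \<open>f\<close> disagrees infinitely often
  with the trivializing map \<open>h\<close>. The pairs \<open>(f y, h y)\<close> form a CSN family except for the density
  requirement. To obtain density, \<open>f\<close> is replaced by the lifting along a section \<open>\<phi>\<close> of a Borel map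
  with dense fibres; \<open>\<phi>\<close> need not be Borel, so it can be chosen to map each of the \<open>\<omega>\<^sub>1\<close> sets onto
  a dense set.
\<close>

section \<open>Combinatorics of disjoint families and of pairs of maps\<close>

text \<open>By Zorn there is a maximal disjoint family of sets satisfying \<open>P\<close>. If it
  were countable, so would be its union, and some \<open>Z\<close> avoiding that union could be
  added; being nonempty, \<open>Z\<close> is new.\<close>

lemma uncountable_disjoint_family:
  assumes avoid: "\<And>W. countable W \<Longrightarrow> \<exists>Z. P Z \<and> Z \<inter> W = {}"
    and P: "\<And>Z. P Z \<Longrightarrow> countable Z \<and> Z \<noteq> {}"
  obtains \<Z> where "uncountable \<Z>" "disjoint \<Z>" "\<And>Z. Z \<in> \<Z> \<Longrightarrow> P Z"
proof -
  let ?S = "{\<Z>. disjoint \<Z> \<and> (\<forall>Z \<in> \<Z>. P Z)}"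
  have "\<exists>M \<in> ?S. \<forall>X \<in> ?S. M \<subseteq> X \<longrightarrow> X = M"
  proof (rule subset_Zorn')
    fix C assume C: "subset.chain ?S C"
    then have sub: "C \<subseteq> ?S" and lin: "\<And>x y. x \<in> C \<Longrightarrow> y \<in> C \<Longrightarrow> x \<subseteq> y \<or> y \<subseteq> x"
      unfolding subset_chain_def by blast+
    have "X \<inter> Y = {}" if XY: "X \<in> \<Union>C" "Y \<in> \<Union>C" "X \<noteq> Y" for X Y
    proof -
      obtain \<Z> where "\<Z> \<in> C" "X \<in> \<Z>" "Y \<in> \<Z>"
        using XY lin by blast
      then show ?thesis using sub XY by (auto dest: disjointD)
    qed
    then show "\<Union>C \<in> ?S" using sub by (auto intro!: disjointI)
  qed
  then obtain M where MS: "M \<in> ?S" and MX: "\<forall>X \<in> ?S. M \<subseteq> X \<longrightarrow> X = M"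
    by (rule bexE)
  have M: "disjoint M" "\<forall>Z \<in> M. P Z" using MS by simp_all
  have max: "X = M" if "disjoint X" "\<forall>Z \<in> X. P Z" "M \<subseteq> X" for X
    using MX that by simp
  have "uncountable M"
  proof
    assume "countable M"
    then have "countable (\<Union>M)" using M P countable_UN[of M "\<lambda>Z. Z"] by simp
    then obtain Z where Z: "P Z" "Z \<inter> \<Union>M = {}" using avoid[of "\<Union>M"] by blast
    have "insert Z M = M"
    proof (rule max)
      show "disjoint (insert Z M)"
        using M Z by (auto simp: pairwise_insert disjnt_def)
    qed (use M Z in auto)
    then have "Z \<in> M" by blast
    then have "Z = {}" using Z(2) by blast
    then show False using P[OF Z(1)] by simp
  qed
  then show thesis using that M by blast
qed

text \<open>Points of \<open>Y\<close> are chosen one after another so that their values under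
  \<open>h\<close> and \<open>h'\<close> avoid all values already taken; finite fibres always leave
  such a point. The \<open>h\<close>-values of the sequence form \<open>A\<close>.\<close>

lemma infinite_separating_set:
  fixes h h' :: "'a \<Rightarrow> 'b"
  assumes "infinite Y" and ne: "\<And>y. y \<in> Y \<Longrightarrow> h y \<noteq> h' y"
    and fin: "\<And>a. finite {y \<in> Y. h y = a}" "\<And>a. finite {y \<in> Y. h' y = a}"
  obtains A where "A \<subseteq> h ` Y" "infinite {y \<in> Y. h y \<in> A \<and> h' y \<notin> A}"
proof -
  have step: "\<exists>y \<in> Y. \<forall>z \<in> S. h y \<noteq> h z \<and> h y \<noteq> h' z \<and> h' y \<noteq> h z \<and> h' y \<noteq> h' z"
    if "finite S" for S
  proof -
    define B where "B = (\<Union>z \<in> S. {y \<in> Y. h y = h z} \<union> {y \<in> Y. h y = h' z} \<union>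
        {y \<in> Y. h' y = h z} \<union> {y \<in> Y. h' y = h' z})"
    have "finite B"
      unfolding B_def using that fin by simp
    then have "infinite (Y - B)"
      using \<open>infinite Y\<close> by (rule Diff_infinite_finite)
    then have "Y - B \<noteq> {}" by (rule infinite_imp_nonempty)
    then obtain y where "y \<in> Y - B" by blast
    then show ?thesis unfolding B_def by (intro bexI[of _ y]) auto
  qed
  define pick where "pick S = (SOME y. y \<in> Y \<and>
      (\<forall>z \<in> S. h y \<noteq> h z \<and> h y \<noteq> h' z \<and> h' y \<noteq> h z \<and> h' y \<noteq> h' z))" for S
  have pick: "pick S \<in> Y \<and> (\<forall>z \<in> S. h (pick S) \<noteq> h z \<and> h (pick S) \<noteq> h' z \<and>
      h' (pick S) \<noteq> h z \<and> h' (pick S) \<noteq> h' z)" if "finite S" for S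
    unfolding pick_def by (rule someI_ex) (use step[OF that] in blast)
  define S where "S n = ((\<lambda>S. insert (pick S) S) ^^ n) {}" for n
  define s where "s n = pick (S n)" for n
  have S_Suc: "S (Suc n) = insert (s n) (S n)" for n
    by (simp add: S_def s_def)
  have finS: "finite (S n)" for n
    by (induction n) (simp_all add: S_Suc, simp add: S_def)
  have sS: "s m \<in> S n" if "m < n" for m n
    using that by (induction n) (auto simp: S_Suc less_Suc_eq)
  have sY: "s n \<in> Y" for n
    using pick[OF finS] by (simp add: s_def)
  have lt: "h (s n) \<noteq> h (s m) \<and> h (s n) \<noteq> h' (s m) \<and> h' (s n) \<noteq> h (s m) \<and> h' (s n) \<noteq> h' (s m)"
    if "m < n" for m n
    using pick[OF finS, of n] sS[OF that] unfolding s_def by blast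
  \<comment> \<open>The case \<open>m = n\<close> is \<open>ne\<close>; otherwise the later of the
    two points was chosen to avoid the values of the earlier one.\<close>
  have "h' (s n) \<noteq> h (s m)" for m n
    using lt[of m n] lt[of n m] ne[OF sY[of n]] by (metis linorder_neqE_nat)
  moreover have "inj s"
    by (rule injI) (metis lt linorder_neqE_nat)
  ultimately have "infinite (range s)" "range s \<subseteq> {y \<in> Y. h y \<in> h ` range s \<and> h' y \<notin> h ` range s}"
    using sY by (auto simp: range_inj_infinite)
  moreover have "h ` range s \<subseteq> h ` Y" using sY by auto
  ultimately show thesis using that infinite_super by blast
qed

section \<open>Borel sets of the Cantor space\<close>

instance bool :: second_countable_topology
proof
  have "open = generate_topology (UNIV :: bool set set)"
    by (auto simp: fun_eq_iff open_discrete intro: generate_topology.Basis)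
  then show "\<exists>B :: bool set set. countable B \<and> open = generate_topology B"
    by (intro exI[of _ UNIV]) (simp add: countable_finite)
qed

text \<open>This form of the Borel sets provides the induction in
  \<open>lifting_mod_countable_ex\<close>.\<close>

lemma sets_borel_cantor:
  "sets (borel :: cantor measure) = sigma_sets UNIV {{x. x i \<in> E} | i E. True}"
proof -
  have bool: "sets (borel :: bool measure) = UNIV"
    by (auto intro!: borel_open simp: open_discrete)
  have "sets (borel :: cantor measure) = sets (Pi\<^sub>M UNIV (\<lambda>_. borel :: bool measure))"
    by (rule sets_PiM_equal_borel[symmetric])
  also have "\<dots> = sigma_sets UNIV {{x. x i \<in> E} | i E. True}"
    unfolding sets_PiM_single by (simp add: bool)
  finally show ?thesis .
qed

section \<open>Representatives of images under \<open>\<pi>\<close>\<close>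

lemma fin_class_surj: obtains A where "x = fin_class A"
  by transfer auto

lemma countable_sym_diff_cong:
  assumes "countable (sym_diff A B)" shows "countable A \<longleftrightarrow> countable B"
proof -
  have "A \<subseteq> B \<union> sym_diff A B" "B \<subseteq> A \<union> sym_diff A B" by auto
  then show ?thesis using assms by (meson countable_Un countable_subset)
qed

locale cardinality_preserving_automorphism =
  fixes \<pi> :: "'a pow_fin \<Rightarrow> 'a pow_fin"
  assumes aut: "boolean_algebra_automorphism \<pi>"
    and cp: "cardinality_preserving \<pi>"
begin

text \<open>A relation, since a set representing the image of a class is determined only modulo
  finite sets.\<close>

definition rep :: "'a set \<Rightarrow> 'a set \<Rightarrow> bool" where
  "rep A B \<longleftrightarrow> \<pi> (fin_class A) = fin_class B"

lemma rep_ex: obtains B where "rep A B"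
  unfolding rep_def by (metis fin_class_surj)

lemma rep_ex_inv: obtains A where "rep A B"
proof -
  obtain x where "\<pi> x = fin_class B"
    using aut unfolding boolean_algebra_automorphism_def by (metis bij_pointE)
  then show thesis using that fin_class_surj unfolding rep_def by metis
qed

lemma rep_Int: "rep A B \<Longrightarrow> rep A' B' \<Longrightarrow> rep (A \<inter> A') (B \<inter> B')"
  using aut unfolding rep_def boolean_algebra_automorphism_def
  by (metis inf_pow_fin.abs_eq fin_class.abs_eq)

lemma rep_Un: "rep A B \<Longrightarrow> rep A' B' \<Longrightarrow> rep (A \<union> A') (B \<union> B')"
  using aut unfolding rep_def boolean_algebra_automorphism_def
  by (metis sup_pow_fin.abs_eq fin_class.abs_eq)

lemma rep_Compl: "rep A B \<Longrightarrow> rep (- A) (- B)"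
  using aut unfolding rep_def boolean_algebra_automorphism_def
  by (metis uminus_pow_fin.abs_eq fin_class.abs_eq)

lemma rep_Diff: "rep A B \<Longrightarrow> rep A' B' \<Longrightarrow> rep (A - A') (B - B')"
  unfolding Diff_eq by (intro rep_Int rep_Compl)

lemma rep_finite_iff: assumes "rep A B" shows "finite A \<longleftrightarrow> finite B"
proof -
  have "\<pi> (fin_class {}) = fin_class {}"
    using aut unfolding boolean_algebra_automorphism_def
    by (metis bot_pow_fin.abs_eq fin_class.abs_eq)
  moreover have "inj \<pi>"
    using aut unfolding boolean_algebra_automorphism_def by (simp add: bij_is_inj)
  ultimately have "fin_class A = fin_class {} \<longleftrightarrow> fin_class B = fin_class {}"
    using assms unfolding rep_def by (metis injD)
  then show ?thesis by (simp add: fin_class_eq_iff)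
qed

text \<open>Cardinality preservation gives one representative of the size of \<open>A\<close>, and a
  finite change does not affect countability.\<close>

lemma rep_countable_iff: assumes "rep A B" shows "countable A \<longleftrightarrow> countable B"
proof -
  obtain B' where B': "|B'| =o |A|" "fin_class B = fin_class B'"
    using cp assms unfolding cardinality_preserving_def rep_def by metis
  then have "countable B \<longleftrightarrow> countable B'"
    by (intro countable_sym_diff_cong) (simp add: fin_class_eq_iff countable_finite)
  moreover have "countable B' \<longleftrightarrow> countable A"
    using B' unfolding countable_card_le_natLeq by (meson ordIso_ordLeq_trans ordIso_symmetric)
  ultimately show ?thesis by simp
qed

lemma rep_unique: "rep A B \<Longrightarrow> rep A B' \<Longrightarrow> finite (sym_diff B B')"
  unfolding rep_def by (simp add: fin_class_eq_iff)

lemma rep_finite_Diff: "rep A B \<Longrightarrow> rep A' B' \<Longrightarrow> finite (A - A') \<longleftrightarrow> finite (B - B')"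
  by (intro rep_finite_iff rep_Diff)

lemma rep_finite_Int: "rep A B \<Longrightarrow> rep A' B' \<Longrightarrow> finite (A \<inter> A') \<longleftrightarrow> finite (B \<inter> B')"
  by (intro rep_finite_iff rep_Int)

section \<open>Point maps that lift \<open>\<pi>\<close> on Borel sets\<close>

text \<open>The error may be countable because countable unions are respected up to countable sets,
  by \<open>rep_UN_countable_Diff\<close>.\<close>

definition lifting_mod_countable :: "('a \<Rightarrow> cantor) \<Rightarrow> ('a \<Rightarrow> cantor) \<Rightarrow> bool" where
  "lifting_mod_countable \<phi> F \<longleftrightarrow>
     (\<forall>A \<in> sets borel. \<forall>B. rep (\<phi> -` A) B \<longrightarrow> countable (sym_diff (F -` A) B))"

text \<open>Each \<open>B n\<close> is almost contained in \<open>C\<close>. The rest of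
  \<open>C\<close> is pulled back to some \<open>M\<close> that has finite intersection with every
  \<open>P n\<close> and almost lies in their union; so \<open>M\<close> is countable, and hence so
  is the rest.\<close>

lemma rep_UN_countable_Diff:
  fixes P :: "nat \<Rightarrow> 'a set"
  assumes "\<And>n. rep (P n) (B n)" and "rep (\<Union>n. P n) C"
  shows "countable (sym_diff (\<Union>n. B n) C)"
proof -
  have "finite (B n - C)" for n
  proof -
    have "P n - (\<Union>n. P n) = {}" by auto
    then show ?thesis
      using rep_finite_Diff[OF assms(1)[of n] assms(2)] by (simp only: finite.emptyI simp_thms)
  qed
  then have "countable (\<Union>n. B n - C)"
    by (intro countable_UN countableI_type countable_finite)
  then have 1: "countable ((\<Union>n. B n) - C)"
    by (rule countable_subset[rotated]) auto
  obtain M where M: "rep M (C - (\<Union>n. B n))" by (rule rep_ex_inv)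
  have "finite (M \<inter> P n)" for n
  proof -
    have "(C - (\<Union>n. B n)) \<inter> B n = {}" by auto
    then show ?thesis using rep_finite_Int[OF M assms(1)[of n]] by simp
  qed
  moreover have "finite (M - (\<Union>n. P n))"
  proof -
    have "C - (\<Union>n. B n) - C = {}" by auto
    then show ?thesis
      using rep_finite_Diff[OF M assms(2)] by (simp only: finite.emptyI simp_thms)
  qed
  ultimately have "countable ((M - (\<Union>n. P n)) \<union> (\<Union>n. M \<inter> P n))"
    by (intro countable_Un countable_UN countableI_type countable_finite)
  then have "countable M" by (rule countable_subset[rotated]) auto
  then have "countable (C - (\<Union>n. B n))" using rep_countable_iff[OF M] by simp
  then show ?thesis using 1 by simp
qed

text \<open>The coordinates of \<open>F y\<close> record which of the sets \<open>V k\<close>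
  contain \<open>y\<close>, so \<open>F\<close> is exact on the subbasic sets. Induction over the
  generated \<sigma>-algebra does the rest.\<close>

lemma lifting_mod_countable_ex: obtains F where "lifting_mod_countable \<phi> F"
proof -
  define V where "V k = (SOME B. rep (\<phi> -` {x. x k}) B)" for k :: nat
  have V: "rep (\<phi> -` {x. x k}) (V k)" for k
    unfolding V_def by (rule someI_ex) (metis rep_ex)
  define F where "F y k \<longleftrightarrow> y \<in> V k" for y k
  \<comment> \<open>Representatives of one class differ finitely, so it suffices to check one of
    them.\<close>
  have unif: "countable (sym_diff S B)" if "rep A B'" "countable (sym_diff S B')" "rep A B" for S A B B'
  proof (rule countable_subset)
    show "countable (sym_diff S B' \<union> sym_diff B' B)"
      using that rep_unique[of A B' B] by (auto simp: countable_finite)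
  qed blast
  have "\<forall>B. rep (\<phi> -` A) B \<longrightarrow> countable (sym_diff (F -` A) B)"
    if "A \<in> sigma_sets UNIV {{x. x i \<in> E} | i E. True}" for A
    using that
  proof induction
    case (Basic A)
    then obtain i E where A: "A = {x :: cantor. x i \<in> E}" by blast
    have A': "A = {x. x i \<and> True \<in> E \<or> \<not> x i \<and> False \<in> E}"
      unfolding A by (rule Collect_cong) (metis (full_types))
    have "rep (\<phi> -` A) (F -` A)"
    proof (cases "True \<in> E"; cases "False \<in> E")
      assume "True \<in> E" "False \<in> E"
      then have "A = UNIV" unfolding A' by auto
      \<comment> \<open>The whole space arises as a set joined with its complement; the index
        \<open>0\<close> is arbitrary.\<close>
      then show ?thesis using rep_Un[OF V[of 0] rep_Compl[OF V[of 0]]] by simp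
    next
      assume "True \<in> E" "False \<notin> E"
      then have "A = {x. x i}" unfolding A' by auto
      then show ?thesis using V[of i] by (simp add: F_def vimage_def)
    next
      assume "True \<notin> E" "False \<in> E"
      then have "A = - {x. x i}" unfolding A' by auto
      then show ?thesis using rep_Compl[OF V[of i]] by (simp add: F_def vimage_def Compl_eq)
    next
      assume "True \<notin> E" "False \<notin> E"
      then have "A = {}" unfolding A' by auto
      then show ?thesis using rep_Int[OF V[of 0] rep_Compl[OF V[of 0]]] by simp
    qed
    then show ?case using unif[of "\<phi> -` A" "F -` A" "F -` A"] by simp
  next
    case Empty
    have "rep {} {}" using rep_Int[OF V[of 0] rep_Compl[OF V[of 0]]] by simp
    then show ?case using unif[of "{}" "{}" "{}"] by simp
  next
    case (Compl A)
    obtain B where B: "rep (\<phi> -` A) B" by (rule rep_ex)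
    have "countable (sym_diff (F -` A) B)" using Compl B by blast
    moreover have "sym_diff (F -` (UNIV - A)) (- B) = sym_diff (F -` A) B" by auto
    moreover have "rep (\<phi> -` (UNIV - A)) (- B)"
      using rep_Compl[OF B] by (simp add: Compl_eq_Diff_UNIV vimage_Diff)
    ultimately show ?case using unif by metis
  next
    case (Union A)
    define B where "B n = (SOME B. rep (\<phi> -` A n) B)" for n
    have B: "rep (\<phi> -` A n) (B n)" for n
      unfolding B_def by (rule someI_ex) (metis rep_ex)
    show ?case
    proof (intro allI impI)
      fix C assume C: "rep (\<phi> -` (\<Union>n. A n)) C"
      have "countable (\<Union>n. sym_diff (F -` A n) (B n))"
        using Union B by blast
      moreover have "countable (sym_diff (\<Union>n. B n) C)"
        using rep_UN_countable_Diff[of "\<lambda>n. \<phi> -` A n" B C] B C by (simp add: vimage_UN)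
      ultimately have "countable ((\<Union>n. sym_diff (F -` A n) (B n)) \<union> sym_diff (\<Union>n. B n) C)"
        by blast
      then show "countable (sym_diff (F -` (\<Union>n. A n)) C)"
        by (rule countable_subset[rotated]) blast
    qed
  qed
  then have "lifting_mod_countable \<phi> F"
    unfolding lifting_mod_countable_def sets_borel_cantor by blast
  then show thesis by (rule that)
qed

section \<open>Trivializations over a set and their uniqueness modulo finite sets\<close>

text \<open>The witnesses hidden in \<open>trivial_map_on\<close> become parameters, so that
  different ones can be compared.\<close>

definition trivializes :: "'a set \<Rightarrow> 'a set \<Rightarrow> ('a \<Rightarrow> 'a) \<Rightarrow> bool" where
  "trivializes Z D h \<longleftrightarrow> h \<in> D \<rightarrow> Z \<and> (\<forall>A \<subseteq> Z. rep A {x \<in> D. h x \<in> A})"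

lemma trivializesD: "trivializes Z D h \<Longrightarrow> A \<subseteq> Z \<Longrightarrow> rep A {x \<in> D. h x \<in> A}"
  unfolding trivializes_def by blast

lemma trivializes_rep: assumes "trivializes Z D h" shows "rep Z D"
proof -
  have "{x \<in> D. h x \<in> Z} = D" using assms unfolding trivializes_def by auto
  then show ?thesis using trivializesD[OF assms, of Z] by simp
qed

lemma trivializes_subset:
  assumes "trivializes Z D h" "Z' \<subseteq> Z" shows "trivializes Z' {x \<in> D. h x \<in> Z'} h"
proof -
  have "{x \<in> {x \<in> D. h x \<in> Z'}. h x \<in> A} = {x \<in> D. h x \<in> A}" if "A \<subseteq> Z'" for A
    using that by auto
  then show ?thesis using assms unfolding trivializes_def by auto
qed

lemma trivializes_finite_fibre:
  assumes "trivializes Z D h" shows "finite {y \<in> D. h y = a}"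
proof (cases "a \<in> Z")
  case True
  then show ?thesis
    using rep_finite_iff[OF trivializesD[OF assms, of "{a}"]] by simp
next
  case False
  then have "{y \<in> D. h y = a} = {}" using assms unfolding trivializes_def by auto
  then show ?thesis by (simp only: finite.emptyI)
qed

text \<open>Infinite disagreement would give, by \<open>infinite_separating_set\<close>, an
  \<open>A\<close> whose preimages under the two maps differ infinitely although both represent the
  image of \<open>A\<close>.\<close>

lemma trivializes_unique:
  assumes h: "trivializes Z D h" and h': "trivializes Z D' h'"
  shows "finite {y \<in> D \<inter> D'. h y \<noteq> h' y}"
proof (rule ccontr)
  let ?Y = "{y \<in> D \<inter> D'. h y \<noteq> h' y}"
  assume "infinite ?Y"
  then obtain A where A: "A \<subseteq> h ` ?Y" "infinite {y \<in> ?Y. h y \<in> A \<and> h' y \<notin> A}"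
  proof (rule infinite_separating_set[where h = h and h' = h'])
    show "finite {y \<in> ?Y. h y = a}" for a
      using trivializes_finite_fibre[OF h, of a] by (rule rev_finite_subset) auto
    show "finite {y \<in> ?Y. h' y = a}" for a
      using trivializes_finite_fibre[OF h', of a] by (rule rev_finite_subset) auto
  qed auto
  have "A \<subseteq> Z" using A h unfolding trivializes_def by auto
  then have "finite (sym_diff {y \<in> D. h y \<in> A} {y \<in> D'. h' y \<in> A})"
    using rep_unique trivializesD[OF h] trivializesD[OF h'] by blast
  moreover have "{y \<in> ?Y. h y \<in> A \<and> h' y \<notin> A} \<subseteq>
      sym_diff {y \<in> D. h y \<in> A} {y \<in> D'. h' y \<in> A}" by auto
  ultimately show False using A finite_subset by blast
qed

text \<open>Failure is witnessed on a countable set: an infinite part of \<open>B\<close> sent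
  outside \<open>A\<close> by \<open>f\<close> contains a countably infinite \<open>Y\<close>, where
  \<open>f\<close> mostly agrees with a trivialization over a countable subset of
  \<open>A\<close>.\<close>

lemma trivial_if_countably_trivial:
  assumes triv: "\<And>Z. countable Z \<Longrightarrow> \<exists>D h. trivializes Z D h"
    and agree: "\<And>Z D h. countable Z \<Longrightarrow> trivializes Z D h \<Longrightarrow> finite {y \<in> D. f y \<noteq> h y}"
  shows "\<pi> (fin_class A) = fin_class (f -` A)"
proof -
  have fin: "finite (B - f -` A)" if AB: "rep A B" for A B
  proof (rule ccontr)
    assume "infinite (B - f -` A)"
    then obtain Y where Y: "countable Y" "infinite Y" "Y \<subseteq> B - f -` A"
      by (metis infinite_countable_subset')
    \<comment> \<open>\<open>Y\<close> is pulled back and cut down to \<open>A\<close>, so that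
      \<open>h\<close> takes its values in \<open>A\<close>.\<close>
    obtain Z0 where "rep Z0 Y" by (rule rep_ex_inv)
    then have Z: "rep (Z0 \<inter> A) Y" using rep_Int[OF _ AB, of Z0 Y] Y
      by (metis Diff_subset inf.absorb1 subset_trans)
    then have "countable (Z0 \<inter> A)" using Y rep_countable_iff by blast
    then obtain D h where h: "trivializes (Z0 \<inter> A) D h" and eq: "finite {y \<in> D. f y \<noteq> h y}"
      using triv agree by meson
    have "finite (Y - D)" using rep_unique[OF Z trivializes_rep[OF h]] by simp
    then have "infinite (Y - (Y - D) - {y \<in> D. f y \<noteq> h y})"
      using Y eq by (metis Diff_infinite_finite)
    then have "Y - (Y - D) - {y \<in> D. f y \<noteq> h y} \<noteq> {}"
      by (metis finite.emptyI)
    then obtain y where "y \<in> Y" "y \<in> D" "f y = h y"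
      by blast
    then show False using h Y unfolding trivializes_def by auto
  qed
  obtain B where B: "rep A B" by (rule rep_ex)
  \<comment> \<open>The claim for the complements is the other half of the symmetric
    difference.\<close>
  have "- B - f -` (- A) = f -` A - B" by auto
  then have "finite (sym_diff B (f -` A))"
    using fin[OF B] fin[OF rep_Compl[OF B]] by simp
  then show ?thesis using B unfolding rep_def by (simp add: fin_class_eq_iff)
qed

text \<open>\<open>D\<close> is split according to whether \<open>h\<close> lands in
  \<open>W\<close>. Off \<open>W\<close>, \<open>agree\<close> applies and \<open>D1\<close> almost
  misses \<open>E\<close>; over \<open>W\<close>, both \<open>h\<close> and \<open>w\<close>
  trivialize \<open>\<pi>\<close> on \<open>Z \<inter> W\<close>, so uniqueness applies.\<close>

lemma finite_disagreement_patch: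
  assumes W: "trivializes W E w"
    and agree: "\<And>Z D h. countable Z \<Longrightarrow> Z \<inter> W = {} \<Longrightarrow> trivializes Z D h \<Longrightarrow>
      finite {y \<in> D. f y \<noteq> h y}"
    and Z: "countable Z" "trivializes Z D h"
  shows "finite {y \<in> D. (if y \<in> E then w y else f y) \<noteq> h y}"
proof -
  define D1 where "D1 = {y \<in> D. h y \<in> Z - W}"
  define D2 where "D2 = {y \<in> D. h y \<in> Z \<inter> W}"
  define E2 where "E2 = {y \<in> E. w y \<in> Z \<inter> W}"
  have t1: "trivializes (Z - W) D1 h" and t2: "trivializes (Z \<inter> W) D2 h"
    and e2: "trivializes (Z \<inter> W) E2 w"
    unfolding D1_def D2_def E2_def
    by (rule trivializes_subset[OF Z(2)] trivializes_subset[OF W]; blast)+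
  have "finite {y \<in> D1. f y \<noteq> h y}" using Z t1 by (intro agree) auto
  moreover have "finite (D1 \<inter> E)"
  proof -
    have "(Z - W) \<inter> W = {}" by auto
    then show ?thesis
      using rep_finite_Int[OF trivializes_rep[OF t1] trivializes_rep[OF W]] by simp
  qed
  moreover have "finite {y \<in> D2 \<inter> E2. h y \<noteq> w y}" by (rule trivializes_unique[OF t2 e2])
  moreover have "finite (D2 - E2)"
    using rep_unique[OF trivializes_rep[OF t2] trivializes_rep[OF e2]] by simp
  ultimately have fin: "finite ({y \<in> D1. f y \<noteq> h y} \<union> (D1 \<inter> E) \<union>
      {y \<in> D2 \<inter> E2. h y \<noteq> w y} \<union> (D2 - E2))" by blast
  have "D \<subseteq> D1 \<union> D2"
    using Z unfolding D1_def D2_def trivializes_def by auto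
  then show ?thesis
    by (intro finite_subset[OF _ fin]) (auto simp: E2_def)
qed

end

section \<open>A Borel map with dense fibres, and liftings along its sections\<close>

text \<open>
  A Borel map all of whose fibres are dense, since it ignores finite modifications of its argument.
\<close>

definition column_limsup :: "cantor \<Rightarrow> cantor" where
  "column_limsup z k \<longleftrightarrow> (\<exists>\<^sub>\<infinity>n. z (prod_encode (k, n)))"

text \<open>The witness for density of the fibres: a point over \<open>x\<close> in the basic open
  set with prefix \<open>l\<close>.\<close>

definition spread :: "bool list \<Rightarrow> cantor \<Rightarrow> cantor" where
  "spread l x m = (if m < length l then l ! m else x (fst (prod_decode m)))"

text \<open>The prefix occupies finitely many places; beyond it, column \<open>k\<close> is
  constantly \<open>x k\<close>.\<close>

lemma column_limsup_spread: "column_limsup (spread l x) = x"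
proof
  fix k
  have "\<forall>\<^sub>\<infinity>n. spread l x (prod_encode (k, n)) = x k"
    unfolding MOST_nat
  proof (intro exI allI impI)
    fix n assume "length l < n"
    then have "\<not> prod_encode (k, n) < length l"
      using le_prod_encode_2[of n k] by linarith
    then show "spread l x (prod_encode (k, n)) = x k" by (simp add: spread_def)
  qed
  then have "column_limsup (spread l x) k \<longleftrightarrow> (\<exists>\<^sub>\<infinity>n :: nat. x k)"
    unfolding column_limsup_def by (rule frequently_cong) simp
  then show "column_limsup (spread l x) k = x k" by simp
qed

lemma borel_coordinate: "{x :: cantor. x i} \<in> sets borel"
proof -
  have "{x :: cantor. x i} = {x. x i \<in> {True}}" by auto
  then show ?thesis unfolding sets_borel_cantor by (intro sigma_sets.Basic) blast
qed

lemma column_limsup_vimage: "column_limsup -` {x. x k} \<in> sets borel"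
proof -
  have "column_limsup -` {x. x k} =
      (\<Inter>m. \<Union>n \<in> {m<..}. {x. x (prod_encode (k, n))})"
    by (auto simp: column_limsup_def INFM_nat)
  also have "\<dots> \<in> sets borel"
    by (intro sets.countable_INT'' sets.countable_UN') (auto intro: borel_coordinate)
  finally show ?thesis .
qed

text \<open>Points of \<open>Z\<close> whose codes are the initial segments of \<open>u\<close> give
  a sequence converging to \<open>u\<close>: coordinate \<open>i\<close> is correct as soon as
  \<open>n > i\<close>.\<close>

lemma dense_spread:
  assumes "\<And>l. \<exists>x \<in> Z. c x = l"
  shows "closure ((\<lambda>x. spread (c x) x) ` Z) = UNIV"
proof -
  have "u \<in> closure ((\<lambda>x. spread (c x) x) ` Z)" for u
  proof -
    have "\<forall>n. \<exists>x. x \<in> Z \<and> c x = map u [0..<n]"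
      using assms by blast
    then obtain x where x: "\<And>n. x n \<in> Z \<and> c (x n) = map u [0..<n]"
      by (auto dest!: choice)
    have "(\<lambda>n. spread (c (x n)) (x n)) \<longlonglongrightarrow> u"
      unfolding limitin_canonical_iff[symmetric] euclidean_product_topology[symmetric]
        limitin_componentwise
    proof (intro conjI ballI)
      fix i
      have "\<forall>\<^sub>F n in sequentially. spread (c (x n)) (x n) i = u i"
        using eventually_gt_at_top[of i] by eventually_elim (simp add: x spread_def)
      then show "limitin euclidean (\<lambda>n. spread (c (x n)) (x n) i) (u i) sequentially"
        unfolding limitin_canonical_iff by (rule tendsto_eventually)
    qed auto
    moreover have "\<forall>\<^sub>F n in sequentially.
        spread (c (x n)) (x n) \<in> closure ((\<lambda>x. spread (c x) x) ` Z)"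
      using x by (intro always_eventually allI subsetD[OF closure_subset] imageI) simp
    ultimately show ?thesis
      by (intro Lim_in_closed_set[OF closed_closure _ sequentially_bot])
  qed
  then show ?thesis by blast
qed

text \<open>An arbitrary lifting \<open>G\<close> along \<open>\<phi>\<close> lies over
  \<open>f\<close> at all but countably many points, since \<open>f\<close> and \<open>G\<close>
  followed by \<open>column_limsup\<close> have the same coordinate preimages up to countable sets.
  Changing countably many values preserves a lifting.\<close>

lemma lifting_mod_countable_section:
  assumes "cardinality_preserving_automorphism \<pi>"
    and id: "cardinality_preserving_automorphism.lifting_mod_countable \<pi> (\<lambda>x. x) f"
    and sec: "\<And>x. column_limsup (\<phi> x) = x"
  obtains F where "cardinality_preserving_automorphism.lifting_mod_countable \<pi> \<phi> F"
    "\<And>y. column_limsup (F y) = f y"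
proof -
  interpret cardinality_preserving_automorphism \<pi> by fact
  obtain G where G: "lifting_mod_countable \<phi> G" by (rule lifting_mod_countable_ex)
  define N where "N = {y. column_limsup (G y) \<noteq> f y}"
  have N: "countable N"
  proof (rule countable_subset)
    show "N \<subseteq> (\<Union>k. sym_diff (G -` column_limsup -` {x. x k}) (f -` {x. x k}))"
      by (auto simp: N_def fun_eq_iff)
    have "countable (sym_diff (G -` column_limsup -` {x. x k}) (f -` {x. x k}))" for k
    proof -
      obtain B where B: "rep {x. x k} B" by (rule rep_ex)
      have "\<phi> -` column_limsup -` {x. x k} = {x. x k}" using sec by auto
      then have "countable (sym_diff (G -` column_limsup -` {x. x k}) B)"
        using G B column_limsup_vimage unfolding lifting_mod_countable_def by metis
      moreover have "countable (sym_diff (f -` {x. x k}) B)"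
        using id B borel_coordinate unfolding lifting_mod_countable_def by (metis vimage_ident)
      ultimately have "countable (sym_diff (G -` column_limsup -` {x. x k}) B \<union>
          sym_diff (f -` {x. x k}) B)" by blast
      then show ?thesis by (rule countable_subset[rotated]) blast
    qed
    then show "countable (\<Union>k. sym_diff (G -` column_limsup -` {x. x k}) (f -` {x. x k}))"
      by blast
  qed
  \<comment> \<open>At the exceptional points, \<open>\<phi> (f y)\<close> serves as a point of the
    fibre over \<open>f y\<close>.\<close>
  define F where "F y = (if y \<in> N then \<phi> (f y) else G y)" for y
  have "lifting_mod_countable \<phi> F"
    unfolding lifting_mod_countable_def
  proof (intro ballI allI impI)
    fix A B assume "A \<in> sets borel" "rep (\<phi> -` A) B"
    then have "countable (sym_diff (G -` A) B \<union> N)"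
      using G N unfolding lifting_mod_countable_def by blast
    then show "countable (sym_diff (F -` A) B)"
      by (rule countable_subset[rotated]) (auto simp: F_def)
  qed
  moreover have "column_limsup (F y) = f y" for y
    using sec by (simp add: F_def N_def)
  ultimately show thesis by (rule that)
qed

section \<open>A CSN family of size \<open>\<omega>\<^sub>1\<close> built from infinite
  disagreements\<close>

text \<open>Fixes the size at exactly \<open>\<omega>\<^sub>1\<close>, which
  \<open>CSN > \<omega>\<^sub>1\<close> forbids for a CSN family.\<close>

lemma uncountable_subset_cardSuc_natLeq:
  assumes "uncountable A"
  obtains B where "B \<subseteq> A" "|B| =o cardSuc natLeq"
proof -
  have "natLeq <o |A|"
    using assms by (simp add: countable_card_le_natLeq not_ordLeq_iff_ordLess
        natLeq_Well_order card_of_Well_order)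
  then have "cardSuc natLeq \<le>o |A|"
    by (simp add: cardSuc_least card_of_Card_order natLeq_Card_order)
  moreover have F: "|Field (cardSuc natLeq)| =o cardSuc natLeq"
    by (simp add: card_of_Field_ordIso cardSuc_Card_order natLeq_Card_order)
  ultimately have "|Field (cardSuc natLeq)| \<le>o |A|"
    using ordIso_ordLeq_trans by blast
  from this[THEN internalize_card_of_ordLeq2[THEN iffD1]]
  obtain B where "B \<subseteq> A" and B: "|Field (cardSuc natLeq)| =o |B|"
    by (elim exE conjE)
  have "|B| =o cardSuc natLeq"
    using ordIso_symmetric[OF B] F by (rule ordIso_transitive)
  with \<open>B \<subseteq> A\<close> show thesis by (rule that)
qed

text \<open>Each chosen \<open>Z\<close> contributes the pair of sequences \<open>F y\<close> and
  \<open>\<phi> (h Z y)\<close>, with \<open>y\<close> enumerating its disagreement set. These pairs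
  form a CSN family of size \<open>\<omega>\<^sub>1\<close>.\<close>

lemma no_bad_family:
  fixes \<pi> :: "cantor pow_fin \<Rightarrow> cantor pow_fin"
  assumes csn: "cardSuc natLeq <o CSN (sets (borel :: cantor measure))"
    and cpa: "cardinality_preserving_automorphism \<pi>"
    and id: "cardinality_preserving_automorphism.lifting_mod_countable \<pi> (\<lambda>x. x) f"
    and unc: "uncountable \<Y>" and dis: "disjoint \<Y>"
    and bad: "\<And>Z. Z \<in> \<Y> \<Longrightarrow> countable Z \<and>
      (\<exists>D h. cardinality_preserving_automorphism.trivializes \<pi> Z D h \<and>
        infinite {y \<in> D. f y \<noteq> h y} \<and> Z = h ` {y \<in> D. f y \<noteq> h y})"
  shows False
proof -
  interpret cardinality_preserving_automorphism \<pi> by fact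
  obtain \<Z> where "\<Z> \<subseteq> \<Y>" and size: "|\<Z>| =o cardSuc natLeq"
    using unc by (rule uncountable_subset_cardSuc_natLeq)
  have disZ: "Z = Z'" if "Z \<in> \<Z>" "Z' \<in> \<Z>" "x \<in> Z" "x \<in> Z'" for Z Z' x
    using dis that \<open>\<Z> \<subseteq> \<Y>\<close> unfolding disjoint_def by blast
  have "\<forall>Z \<in> \<Z>. \<exists>q. trivializes Z (fst q) (snd q) \<and> infinite {y \<in> fst q. f y \<noteq> snd q y} \<and>
      Z = snd q ` {y \<in> fst q. f y \<noteq> snd q y}"
  proof
    fix Z assume "Z \<in> \<Z>"
    then obtain D h where "trivializes Z D h" "infinite {y \<in> D. f y \<noteq> h y}"
        "Z = h ` {y \<in> D. f y \<noteq> h y}"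
      using bad[of Z] \<open>\<Z> \<subseteq> \<Y>\<close> by auto
    then show "\<exists>q. trivializes Z (fst q) (snd q) \<and> infinite {y \<in> fst q. f y \<noteq> snd q y} \<and>
        Z = snd q ` {y \<in> fst q. f y \<noteq> snd q y}"
      by (intro exI[of _ "(D, h)"]) simp
  qed
  from bchoice[OF this] obtain q where q: "\<forall>Z \<in> \<Z>. trivializes Z (fst (q Z)) (snd (q Z)) \<and>
      infinite {y \<in> fst (q Z). f y \<noteq> snd (q Z) y} \<and>
      Z = snd (q Z) ` {y \<in> fst (q Z). f y \<noteq> snd (q Z) y}" ..
  define D h where "D Z = fst (q Z)" and "h Z = snd (q Z)" for Z
  have h: "trivializes Z (D Z) (h Z)" and inf: "infinite {y \<in> D Z. f y \<noteq> h Z y}"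
    and Z_eq: "Z = h Z ` {y \<in> D Z. f y \<noteq> h Z y}" if "Z \<in> \<Z>" for Z
    using q that unfolding D_def h_def by blast+
  define Y where "Y Z = {y \<in> D Z. f y \<noteq> h Z y}" for Z
  have cZ: "countable Z" if "Z \<in> \<Z>" for Z using that bad \<open>\<Z> \<subseteq> \<Y>\<close> by blast
  have iY: "infinite (Y Z)" if "Z \<in> \<Z>" for Z using inf[OF that] by (simp add: Y_def)
  have hY: "Z = h Z ` Y Z" if "Z \<in> \<Z>" for Z using Z_eq[OF that] by (simp add: Y_def)
  have cY: "countable (Y Z)" if "Z \<in> \<Z>" for Z
  proof -
    have "countable (D Z)" using rep_countable_iff[OF trivializes_rep[OF h[OF that]]] cZ[OF that] by simp
    then show ?thesis by (rule countable_subset[rotated]) (auto simp: Y_def)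
  qed
  have iZ: "infinite Z" if "Z \<in> \<Z>" for Z
  proof
    assume "finite Z"
    then have "finite (D Z)" using rep_finite_iff[OF trivializes_rep[OF h[OF that]]] by simp
    then show False using iY[OF that] by (simp add: Y_def)
  qed
  \<comment> \<open>Numbering each \<open>Z\<close> separately lets the codes on it run through all
    prefixes, which makes its image under \<open>\<phi>\<close> dense. Off the union of
    \<open>\<Z>\<close> the code is arbitrary, as \<open>sec\<close> holds for every code.\<close>
  define c :: "cantor \<Rightarrow> bool list" where
    "c x = from_nat (to_nat_on (THE Z. Z \<in> \<Z> \<and> x \<in> Z) x)" for x
  define \<phi> where "\<phi> x = spread (c x) x" for x
  have c: "\<exists>x \<in> Z. c x = l" if Z: "Z \<in> \<Z>" for Z l
  proof -
    have "to_nat_on Z ` Z = UNIV"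
      using to_nat_on_infinite[OF cZ[OF Z] iZ[OF Z]] by (simp add: bij_betw_def)
    then obtain x where x: "x \<in> Z" "to_nat_on Z x = to_nat l" by (metis UNIV_I imageE)
    have "(THE Z. Z \<in> \<Z> \<and> x \<in> Z) = Z"
    proof (rule the_equality)
      show "Z' = Z" if "Z' \<in> \<Z> \<and> x \<in> Z'" for Z'
        by (rule disZ[of Z' Z x]) (use that Z x in simp_all)
    qed (use Z x in simp)
    then show ?thesis using x by (intro bexI[of _ x]) (simp_all add: c_def)
  qed
  have sec: "column_limsup (\<phi> x) = x" for x
    by (simp add: \<phi>_def column_limsup_spread)
  obtain F where F: "lifting_mod_countable \<phi> F" and colF: "\<And>y. column_limsup (F y) = f y"
    by (rule lifting_mod_countable_section[OF cpa id sec]) blast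
  define p where "p Z = (F \<circ> from_nat_into (Y Z), \<phi> \<circ> h Z \<circ> from_nat_into (Y Z))" for Z
  have range_e: "range (from_nat_into (Y Z)) = Y Z" if "Z \<in> \<Z>" for Z
    using bij_betw_from_nat_into[OF cY iY, OF that that] by (simp add: bij_betw_def)
  have inj_e: "inj (from_nat_into (Y Z))" if "Z \<in> \<Z>" for Z
    using bij_betw_from_nat_into[OF cY iY, OF that that] by (simp add: bij_betw_def)
  have range_g: "range (snd (p Z)) = \<phi> ` Z" if "Z \<in> \<Z>" for Z
    unfolding p_def snd_conv image_comp[symmetric] range_e[OF that] hY[OF that, symmetric] ..
  \<comment> \<open>A section is injective, so disjointness passes to the images.\<close>
  have disg: "Z = Z'" if ZZ: "Z \<in> \<Z>" "Z' \<in> \<Z>" "\<phi> ` Z \<inter> \<phi> ` Z' \<noteq> {}" for Z Z'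
  proof -
    obtain x x' where x: "x \<in> Z" "x' \<in> Z'" "\<phi> x = \<phi> x'" using ZZ by blast
    then have "x = x'" using sec by metis
    then show ?thesis using x ZZ disZ by blast
  qed
  \<comment> \<open>\<open>column_limsup\<close> maps the two points to \<open>f y\<close> and
    \<open>h Z y\<close>, which differ on \<open>Y Z\<close>.\<close>
  have neq: "F y \<noteq> \<phi> (h Z y)" if "y \<in> Y Z" for y Z
    using that colF[of y] sec[of "h Z y"] by (auto simp: Y_def)
  have inj_p: "inj_on p \<Z>"
  proof (rule inj_onI)
    fix Z Z' assume *: "Z \<in> \<Z>" "Z' \<in> \<Z>" "p Z = p Z'"
    then have "\<phi> ` Z = \<phi> ` Z'" using range_g by metis
    moreover have "\<phi> ` Z \<noteq> {}" using iZ[OF *(1)] by auto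
    ultimately show "Z = Z'" using disg * by blast
  qed
  then have "|\<Z>| =o |p ` \<Z>|"
    by (meson bij_betw_imageI card_of_ordIsoI)
  then have size_p: "|p ` \<Z>| =o cardSuc natLeq"
    using size by (meson ordIso_symmetric ordIso_transitive)
  \<comment> \<open>The countable error \<open>N\<close> of \<open>F\<close> at \<open>A\<close> is
    pulled back to a countable \<open>M\<close>. Only those \<open>Z\<close> that meet
    \<open>M\<close> can have infinitely many pairs split by \<open>A\<close>, and by disjointness
    there are countably many of them.\<close>
  have few: "countable {Z \<in> \<Z>. infinite {n. card (A \<inter> {fst (p Z) n, snd (p Z) n}) = 1}}" (is "countable ?T")
    if A: "A \<in> sets borel" for A
  proof -
    obtain B where B: "rep (\<phi> -` A) B" by (rule rep_ex)
    define N where "N = sym_diff (F -` A) B"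
    have N: "countable N" using F A B unfolding lifting_mod_countable_def N_def by blast
    obtain M where M: "rep M N" by (rule rep_ex_inv)
    have "countable M" using N rep_countable_iff[OF M] by simp
    have meets: "Z \<inter> M \<noteq> {}" if T: "Z \<in> ?T" for Z
    proof
      assume "Z \<inter> M = {}"
      have Z: "Z \<in> \<Z>" using T by simp
      let ?e = "from_nat_into (Y Z)"
      have eY: "?e n \<in> Y Z" for n using range_e[OF Z] by blast
      have fin: "finite (D Z \<inter> N)"
        using rep_finite_Int[OF trivializes_rep[OF h[OF Z]] M] \<open>Z \<inter> M = {}\<close> by simp
      have "rep (\<phi> -` A \<inter> Z) {y \<in> D Z. h Z y \<in> \<phi> -` A \<inter> Z}"
        by (rule trivializesD[OF h[OF Z]]) auto
      then have "finite (sym_diff {y \<in> D Z. h Z y \<in> \<phi> -` A \<inter> Z} (B \<inter> D Z))"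
        using rep_unique rep_Int[OF B trivializes_rep[OF h[OF Z]]] by blast
      then have fin': "finite ((D Z \<inter> N) \<union> sym_diff {y \<in> D Z. h Z y \<in> \<phi> -` A \<inter> Z} (B \<inter> D Z))" (is "finite ?U")
        using fin by blast
      \<comment> \<open>Outside \<open>?U\<close>, the points \<open>F y\<close> and
        \<open>\<phi> (h Z y)\<close> with \<open>y\<close> in \<open>Y Z\<close> lie on the same
        side of \<open>A\<close>.\<close>
      have "?e n \<in> ?U" if "card (A \<inter> {fst (p Z) n, snd (p Z) n}) = 1" for n
      proof -
        have "h Z (?e n) \<in> Z" using hY[OF Z] eY[of n] by blast
        moreover have "?e n \<in> D Z" using eY[of n] by (simp add: Y_def)
        moreover have "F (?e n) \<in> A \<longleftrightarrow> \<phi> (h Z (?e n)) \<notin> A"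
          using that neq[OF eY[of n]] by (auto simp: p_def Int_insert_right split: if_splits)
        ultimately show ?thesis by (auto simp: N_def)
      qed
      then have "{n. card (A \<inter> {fst (p Z) n, snd (p Z) n}) = 1} \<subseteq> ?e -` ?U" by blast
      moreover have "finite (?e -` ?U)" using fin' inj_e[OF Z] by (rule finite_vimageI)
      ultimately show False using T finite_subset by blast
    qed
    define m where "m Z = (SOME x. x \<in> Z \<inter> M)" for Z
    have m: "m Z \<in> Z \<inter> M" if "Z \<in> ?T" for Z
      using meets[OF that] unfolding m_def by (rule some_in_eq[THEN iffD2])
    have "inj_on m ?T"
    proof (rule inj_onI)
      fix Z Z' assume "Z \<in> ?T" "Z' \<in> ?T" "m Z = m Z'"
      then show "Z = Z'" using m[of Z] m[of Z'] disZ[of Z Z' "m Z"] by simp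
    qed
    moreover have "countable (m ` ?T)"
      using \<open>countable M\<close> by (rule countable_subset[rotated]) (use m in blast)
    ultimately show ?thesis using countable_image_inj_on by blast
  qed
  have "CSN_family (sets borel) (p ` \<Z>)"
    unfolding CSN_family_def
  proof (intro conjI ballI)
    fix q assume "q \<in> p ` \<Z>"
    then obtain Z where Z: "Z \<in> \<Z>" "q = p Z" by blast
    \<comment> \<open>Density comes from the second sequence alone, whose range is the image of all
      of \<open>Z\<close>.\<close>
    have "closure (\<phi> ` Z) = UNIV"
      unfolding \<phi>_def by (rule dense_spread) (rule c[OF Z(1)])
    then have "closure (range (fst q) \<union> range (snd q)) = UNIV"
      unfolding Z(2) range_g[OF Z(1)] by (simp add: closure_Un)
    then show "case q of (f, g) \<Rightarrow> closure (range f \<union> range g) = UNIV"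
      by (simp add: case_prod_beta)
    show "case q of (f, g) \<Rightarrow> \<forall>n. f n \<noteq> g n"
    proof -
      have "from_nat_into (Y Z) n \<in> Y Z" for n
        using range_e[OF Z(1)] by blast
      then show ?thesis using neq by (simp add: Z(2) p_def)
    qed
    show "case q of (f, g) \<Rightarrow> \<forall>(f', g') \<in> p ` \<Z>. g \<noteq> g' \<longrightarrow> range g \<inter> range g' = {}"
    proof (clarsimp simp: case_prod_beta)
      fix Z' assume Z': "Z' \<in> \<Z>" "snd q \<noteq> snd (p Z')"
      then show "range (snd q) \<inter> range (snd (p Z')) = {}"
        using disg[OF Z(1) Z'(1)] range_g[OF Z(1)] range_g[OF Z'(1)] Z by auto
    qed
  next
    fix A :: "cantor set" assume A: "A \<in> sets borel"
    have "{(f, g) \<in> p ` \<Z>. infinite {n. card (A \<inter> {f n, g n}) = 1}} =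
        p ` {Z \<in> \<Z>. infinite {n. card (A \<inter> {fst (p Z) n, snd (p Z) n}) = 1}}"
      unfolding case_prod_beta prod.collapse by blast
    then have "countable {(f, g) \<in> p ` \<Z>. infinite {n. card (A \<inter> {f n, g n}) = 1}}"
      using few[OF A] by simp
    then have "|{(f, g) \<in> p ` \<Z>. infinite {n. card (A \<inter> {f n, g n}) = 1}}| \<le>o natLeq"
      by (simp add: countable_card_le_natLeq)
    also have "natLeq <o cardSuc natLeq"
      by (simp add: cardSuc_greater natLeq_Card_order)
    also have "cardSuc natLeq =o |p ` \<Z>|"
      using size_p by (rule ordIso_symmetric)
    finally show "|{(f, g) \<in> p ` \<Z>. infinite {n. card (A \<inter> {f n, g n}) = 1}}| <o |p ` \<Z>|" .
  qed
  then have "CSN (sets borel) \<le>o |p ` \<Z>|"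
    using is_CSN_CSN[of "sets borel"] unfolding is_CSN_def by meson
  then have "CSN (sets (borel :: cantor measure)) \<le>o cardSuc natLeq"
    using size_p ordLeq_ordIso_trans by blast
  then show False using csn not_ordLess_ordLeq by blast
qed

section \<open>Triviality of \<open>\<pi>\<close> by patching the lifting on a countable set\<close>

theorem theorem4p4:
  fixes \<pi> :: "cantor pow_fin \<Rightarrow> cantor pow_fin"
  assumes "cardSuc natLeq <o CSN (sets (borel :: cantor measure))"
    and "boolean_algebra_automorphism \<pi>"
    and "cardinality_preserving \<pi>"
    and "\<And>Z :: cantor set. countable Z \<Longrightarrow> trivial_map_on Z \<pi>"
  shows "trivial_map \<pi>"
proof -
  interpret cardinality_preserving_automorphism \<pi>
    using assms by unfold_locales
  have triv: "\<exists>D h. trivializes Z D h" if "countable Z" for Z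
    using assms(4)[OF that] unfolding trivial_map_on_def trivializes_def rep_def by blast
  obtain f where f: "lifting_mod_countable (\<lambda>x. x) f" by (rule lifting_mod_countable_ex)
  \<comment> \<open>\<open>Z\<close> has to be the full image of the disagreement set, so that
    enumerating that set exhausts \<open>Z\<close> and yields a dense range.\<close>
  define bad where "bad Z \<longleftrightarrow> countable Z \<and> (\<exists>D h. trivializes Z D h \<and>
      infinite {y \<in> D. f y \<noteq> h y} \<and> Z = h ` {y \<in> D. f y \<noteq> h y})" for Z
  \<comment> \<open>Otherwise every countable set is avoided by a bad set, which produces the family
    excluded by \<open>no_bad_family\<close>.\<close>
  have "\<exists>W. countable W \<and> (\<forall>Z. bad Z \<longrightarrow> Z \<inter> W \<noteq> {})"
  proof (rule ccontr)
    assume "\<not> ?thesis"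
    then have "\<exists>Z. bad Z \<and> Z \<inter> W = {}" if "countable W" for W using that by blast
    moreover have "countable Z \<and> Z \<noteq> {}" if "bad Z" for Z
      using that unfolding bad_def by (metis finite.emptyI image_is_empty)
    ultimately obtain \<Z> where "uncountable \<Z>" "disjoint \<Z>" "\<And>Z. Z \<in> \<Z> \<Longrightarrow> bad Z"
      using uncountable_disjoint_family[of bad] by blast
    then show False
      using no_bad_family[OF assms(1) cardinality_preserving_automorphism_axioms f]
      unfolding bad_def by blast
  qed
  then obtain W where W: "countable W" "\<And>Z. bad Z \<Longrightarrow> Z \<inter> W \<noteq> {}" by blast
  \<comment> \<open>\<open>w\<close> will replace \<open>f\<close> on \<open>E\<close>.\<close>
  obtain E w where w: "trivializes W E w" using triv[OF W(1)] by blast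
  have agree: "finite {y \<in> D. f y \<noteq> h y}"
    if Z: "countable Z" "Z \<inter> W = {}" "trivializes Z D h" for Z D h
  proof (rule ccontr)
    assume inf: "infinite {y \<in> D. f y \<noteq> h y}"
    \<comment> \<open>Shrinking \<open>Z\<close> to the values of \<open>h\<close> at the
      disagreements loses none of them and makes the set bad.\<close>
    let ?Z = "h ` {y \<in> D. f y \<noteq> h y}"
    have sub: "?Z \<subseteq> Z" using Z unfolding trivializes_def by auto
    have eq: "{y \<in> {y \<in> D. h y \<in> ?Z}. f y \<noteq> h y} = {y \<in> D. f y \<noteq> h y}" by auto
    have "bad ?Z"
      unfolding bad_def
    proof (intro conjI exI)
      show "countable ?Z" using sub Z countable_subset by blast
      show "trivializes ?Z {y \<in> D. h y \<in> ?Z} h" by (rule trivializes_subset[OF Z(3) sub])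
    qed (simp_all only: eq inf not_False_eq_True)
    then show False using W(2) sub Z(2) by blast
  qed
  show ?thesis
    unfolding trivial_map_def
  proof (intro exI allI)
    fix A
    show "\<pi> (fin_class A) = fin_class ((\<lambda>y. if y \<in> E then w y else f y) -` A)"
      using triv finite_disagreement_patch[OF w agree] by (rule trivial_if_countably_trivial)
  qed
qed

end
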